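(* Let $(G,\mathcal{B})$ be an instance. Assume there exist a real number $\beta\geq 1$ and an integer $c\geq 1$ such that for every vertex $v$ of $G$, $$c\;\geq\;\beta+\sum_{k\geq 0}\beta^{-k}E_k(v).$$ Then $G$ is $(\mathcal{B},c)$-choosable. Moreover, for every $c$-list-assignment $L$ of $G$, $P(G,\mathcal{B},L)\geq \beta^{|V(G)|}$.
   Context: A hypergraph $G$ has a finite vertex set $V(G)$ and a finite collection $E(G)$ of edges, each a subset of $V(G)$; parallel edges (repeated subsets) are allowed. Let $\mathcal{C}_G$ be the set of all functions $V(G)\to\mathbb{Z}$ (colourings), and for an edge $e$ let $\mathcal{C}_e$ be the set of all functions $e\to\mathbb{Z}$. For an edge $e$ and a family $\mathcal{B}_e\subseteq\mathcal{C}_e$, a subset $S\subseteq e$ determines $\mathcal{B}_e$ if any two colourings in $\mathcal{B}_e$ that agree on $S$ are identical. An instance is a pair $(G,\mathcal{B})$ where $G$ is a hypergraph and $\mathcal{B}=(\mathcal{B}_e\subseteq\mathcal{C}_e : e\in E(G))$, such that for every edge $e$ and every vertex $v\in e$, $\mathcal{B}_e$ is determined by some subset of $e\setminus\{v\}$. A colouring $\phi\in\mathcal{C}_G$ is $\mathcal{B}$-bad if for some edge $e$ the restriction of $\phi$ to $e$ lies in $\mathcal{B}_e$; otherwise it is $\mathcal{B}$-good. For $v\in e$, the weight of the pair $(v,e)$ is $|e|-1-|S|$, where $S$ is a minimum-size subset of $e\setminus\{v\}$ that determines $\mathcal{B}_e$. For a vertex $v$ and integer $k\geq 0$, $E_k(v)$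 is the number of pairs $(v,e)$ (with $e\in E(G)$ containing $v$, counted with multiplicity) of weight $k$. A list-assignment $L$ assigns to each vertex $v$ a set $L(v)\subseteq\mathbb{Z}$; it is a $c$-list-assignment if $|L(v)|=c$ for all $v$. An $L$-colouring is a colouring $\phi$ with $\phi(v)\in L(v)$ for all $v$. $P(G,\mathcal{B},L)$ denotes the number of $\mathcal{B}$-good $L$-colourings of $G$. $G$ is $(\mathcal{B},c)$-choosable if there is a $\mathcal{B}$-good $L$-colouring of $G$ for every $c$-list-assignment $L$ of $G$.
   Formalization: An edge with no vertices is additionally required to have an empty family B_e; otherwise the empty edge with B_e consisting of the empty colouring makes every colouring bad while leaving the inequality on c unaffected. *)

theory Defs
  imports Complex_Main "HOL-Library.FuncSet"
begin

text \<open>Edges are named by elements of a separate type and \<open>ends\<close> gives the underlying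
  vertex set, so that parallel edges are possible.\<close>

record ('v, 'e) hypergraph =
  verts :: "'v set"
  edges :: "'e set"
  ends :: "'e \<Rightarrow> 'v set"

definition is_hypergraph :: "('v, 'e) hypergraph \<Rightarrow> bool" where
  "is_hypergraph G \<longleftrightarrow>
     finite (verts G) \<and> finite (edges G) \<and> (\<forall>e\<in>edges G. ends G e \<subseteq> verts G)"

text \<open>A colouring of a set \<open>A\<close> is a function on \<open>A\<close> only: outside \<open>A\<close> it is \<open>undefined\<close>, so
  equality of colourings of \<open>A\<close> is agreement on \<open>A\<close>, and counting them is meaningful.\<close>

definition colourings :: "'v set \<Rightarrow> ('v \<Rightarrow> int) set" where
  "colourings A = A \<rightarrow>\<^sub>E UNIV"

definition determines :: "'v set \<Rightarrow> ('v \<Rightarrow> int) set \<Rightarrow> bool" where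
  "determines S F \<longleftrightarrow> (\<forall>f\<in>F. \<forall>g\<in>F. (\<forall>x\<in>S. f x = g x) \<longrightarrow> f = g)"

definition is_instance :: "('v, 'e) hypergraph \<Rightarrow> ('e \<Rightarrow> ('v \<Rightarrow> int) set) \<Rightarrow> bool" where
  "is_instance G B \<longleftrightarrow>
     is_hypergraph G \<and>
     (\<forall>e\<in>edges G. B e \<subseteq> colourings (ends G e)) \<and>
     (\<forall>e\<in>edges G. \<forall>v\<in>ends G e. \<exists>S. S \<subseteq> ends G e - {v} \<and> determines S (B e))"

definition bad :: "('v, 'e) hypergraph \<Rightarrow> ('e \<Rightarrow> ('v \<Rightarrow> int) set) \<Rightarrow> ('v \<Rightarrow> int) \<Rightarrow> bool" where
  "bad G B \<phi> \<longleftrightarrow> (\<exists>e\<in>edges G. restrict \<phi> (ends G e) \<in> B e)"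

abbreviation good :: "('v, 'e) hypergraph \<Rightarrow> ('e \<Rightarrow> ('v \<Rightarrow> int) set) \<Rightarrow> ('v \<Rightarrow> int) \<Rightarrow> bool" where
  "good G B \<phi> \<equiv> \<not> bad G B \<phi>"

text \<open>In an instance with \<open>v \<in> ends G e\<close> the set under \<open>Min\<close> is finite, nonempty and bounded by
  \<open>card (ends G e) - 1\<close>, so the subtractions do not truncate.\<close>

definition weight :: "('v, 'e) hypergraph \<Rightarrow> ('e \<Rightarrow> ('v \<Rightarrow> int) set) \<Rightarrow> 'v \<Rightarrow> 'e \<Rightarrow> nat" where
  "weight G B v e =
     card (ends G e) - 1 - Min {card S | S. S \<subseteq> ends G e - {v} \<and> determines S (B e)}"

definition E_count :: "('v, 'e) hypergraph \<Rightarrow> ('e \<Rightarrow> ('v \<Rightarrow> int) set) \<Rightarrow> nat \<Rightarrow> 'v \<Rightarrow> nat" where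
  "E_count G B k v = card {e \<in> edges G. v \<in> ends G e \<and> weight G B v e = k}"

definition list_assignment :: "('v, 'e) hypergraph \<Rightarrow> nat \<Rightarrow> ('v \<Rightarrow> int set) \<Rightarrow> bool" where
  "list_assignment G c L \<longleftrightarrow> (\<forall>v\<in>verts G. finite (L v) \<and> card (L v) = c)"

definition list_colourings :: "('v, 'e) hypergraph \<Rightarrow> ('v \<Rightarrow> int set) \<Rightarrow> ('v \<Rightarrow> int) set" where
  "list_colourings G L = {\<phi> \<in> colourings (verts G). \<forall>v\<in>verts G. \<phi> v \<in> L v}"

definition num_good :: "('v, 'e) hypergraph \<Rightarrow> ('e \<Rightarrow> ('v \<Rightarrow> int) set) \<Rightarrow> ('v \<Rightarrow> int set) \<Rightarrow> nat" where
  "num_good G B L = card {\<phi> \<in> list_colourings G L. good G B \<phi>}"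

definition choosable :: "('v, 'e) hypergraph \<Rightarrow> ('e \<Rightarrow> ('v \<Rightarrow> int) set) \<Rightarrow> nat \<Rightarrow> bool" where
  "choosable G B c \<longleftrightarrow>
     (\<forall>L. list_assignment G c L \<longrightarrow> (\<exists>\<phi>\<in>list_colourings G L. good G B \<phi>))"

end

theory Submission
  imports Defs
begin

text \<open>
  Let \<open>P X\<close> be the number of list colourings of \<open>X \<subseteq> V(G)\<close> that are not bad on any edge contained
  in \<open>X\<close>. We show \<open>P X \<ge> \<beta> ^ card (X - Y) * P Y\<close> for \<open>Y \<subseteq> X\<close> by induction on \<open>X\<close>; the case of
  interest is \<open>P X \<ge> \<beta> * P (X - {v})\<close>. A good colouring of \<open>X - {v}\<close> has \<open>c\<close> extensions to \<open>v\<close>, and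
  an extension fails only because of an edge \<open>e\<close> through \<open>v\<close>. If \<open>S \<subseteq> e - {v}\<close> determines \<open>B e\<close> and
  \<open>R = e - {v} - S\<close>, whose size is the weight of \<open>(v, e)\<close>, then the extensions that fail at \<open>e\<close> are
  recovered from their restrictions to \<open>X - {v} - R\<close>. By induction there are at most
  \<open>P (X - {v} - R) \<le> \<beta> powi (- card R) * P (X - {v})\<close> of them.
\<close>

text \<open>\<open>PiE\<close> fixes the value \<open>undefined\<close> outside \<open>X\<close>, so
  \<open>card\<close> counts colourings of \<open>X\<close> itself and the families for different
  \<open>X\<close> can be compared by restriction.\<close>

definition partial_good ::
  "('v, 'e) hypergraph \<Rightarrow> ('e \<Rightarrow> ('v \<Rightarrow> int) set) \<Rightarrow> ('v \<Rightarrow> int set) \<Rightarrow> 'v set \<Rightarrow> ('v \<Rightarrow> int) set" where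
  "partial_good G B L X =
     {\<phi> \<in> PiE X L. \<forall>e\<in>edges G. ends G e \<subseteq> X \<longrightarrow> restrict \<phi> (ends G e) \<notin> B e}"

lemma partial_good_verts:
  assumes "is_hypergraph G"
  shows "partial_good G B L (verts G) = {\<phi> \<in> list_colourings G L. good G B \<phi>}"
  using assms
  by (auto simp: partial_good_def list_colourings_def colourings_def bad_def is_hypergraph_def
      PiE_iff)

lemma finite_partial_good:
  assumes "finite X" "\<And>x. x \<in> X \<Longrightarrow> finite (L x)"
  shows "finite (partial_good G B L X)"
  using assms by (auto simp: partial_good_def intro: finite_subset[OF _ finite_PiE[of X L]])

lemma partial_good_restrict:
  assumes "\<phi> \<in> partial_good G B L X" "Y \<subseteq> X"
  shows "restrict \<phi> Y \<in> partial_good G B L Y"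
proof -
  have "restrict (restrict \<phi> Y) (ends G e) \<notin> B e" if "e \<in> edges G" "ends G e \<subseteq> Y" for e
    using assms that by (auto simp: partial_good_def inf.absorb2)
  moreover have "restrict \<phi> Y \<in> PiE Y L"
    using assms by (auto simp: partial_good_def)
  ultimately show ?thesis by (auto simp: partial_good_def)
qed

text \<open>Replaces the minimum inside \<open>weight\<close> by a witness. The instance condition
  makes the set of sizes nonempty, and counting the complement of \<open>S\<close> avoids later work
  with truncated subtraction.\<close>

lemma weight_attained:
  assumes "is_instance G B" "e \<in> edges G" "v \<in> ends G e"
  obtains S where "S \<subseteq> ends G e - {v}" "determines S (B e)"
    "card (ends G e - {v} - S) = weight G B v e"
proof -
  let ?M = "{card S | S. S \<subseteq> ends G e - {v} \<and> determines S (B e)}"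
  have fin: "finite (ends G e)"
    using assms by (auto simp: is_instance_def is_hypergraph_def intro: finite_subset)
  have "?M \<subseteq> card ` Pow (ends G e - {v})" by auto
  then have "finite ?M" using fin by (meson finite_Diff finite_Pow_iff finite_imageI finite_subset)
  moreover have "?M \<noteq> {}" using assms by (auto simp: is_instance_def)
  ultimately have "Min ?M \<in> ?M" by (rule Min_in)
  then obtain S where S: "S \<subseteq> ends G e - {v}" "determines S (B e)" "Min ?M = card S" by auto
  have "card (ends G e - {v} - S) = card (ends G e) - 1 - card S"
    using S(1) fin assms(3) by (simp add: card_Diff_subset finite_subset)
  with S that show thesis by (simp add: weight_def)
qed

text \<open>Only finitely many weights occur at \<open>v\<close>, so the series in the hypothesis is
  a finite sum; grouping the edges through \<open>v\<close> by weight turns it into one term per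
  edge, the form a union bound produces.\<close>

lemma suminf_E_count:
  fixes G :: "('v, 'e) hypergraph"
  assumes "finite (edges G)"
  shows "(\<Sum>k. \<beta> powi (- int k) * real (E_count G B k v)) =
    (\<Sum>e | e \<in> edges G \<and> v \<in> ends G e. \<beta> powi (- int (weight G B v e)))"
proof -
  let ?A = "{e \<in> edges G. v \<in> ends G e}"
  let ?w = "weight G B v"
  let ?f = "\<lambda>k. \<beta> powi (- int k) * real (E_count G B k v)"
  have fin: "finite ?A" using assms by simp
  have count: "E_count G B k v = card {e. e \<in> ?A \<and> ?w e = k}" for k
    unfolding E_count_def by (rule arg_cong[of _ _ card]) auto
  have "suminf ?f = sum ?f (?w ` ?A)"
  proof (rule suminf_finite)
    show "finite (?w ` ?A)" using fin by simp
    show "?f k = 0" if "k \<notin> ?w ` ?A" for k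
    proof -
      have "{e. e \<in> ?A \<and> ?w e = k} = {}" using that by auto
      then have "E_count G B k v = 0" unfolding count by (simp only: card.empty)
      then show ?thesis by simp
    qed
  qed
  also have "\<dots> = (\<Sum>k\<in>?w ` ?A. \<Sum>e | e \<in> ?A \<and> ?w e = k. \<beta> powi (- int (?w e)))"
    unfolding count by (intro sum.cong refl) (simp add: mult.commute)
  also have "\<dots> = (\<Sum>e\<in>?A. \<beta> powi (- int (?w e)))"
    by (rule sum.image_gen[OF fin, symmetric])
  finally show ?thesis .
qed

context
  fixes G :: "('v, 'e) hypergraph" and B :: "'e \<Rightarrow> ('v \<Rightarrow> int) set"
    and L :: "'v \<Rightarrow> int set" and c :: nat
  assumes inst: "is_instance G B" and lists: "list_assignment G c L"
begin

private lemma finite_good: "X \<subseteq> verts G \<Longrightarrow> finite (partial_good G B L X)"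
  using inst lists
  by (intro finite_partial_good)
     (auto simp: is_instance_def is_hypergraph_def list_assignment_def intro: finite_subset)

text \<open>The cost of one edge: restriction to \<open>X - R\<close> is injective on the extensions
  that fail at \<open>e\<close>, because their values on \<open>S\<close> force all their values on
  \<open>e\<close>, including those on \<open>R\<close> and at \<open>v\<close>.\<close>

lemma card_bad_extensions:
  assumes X: "insert v X \<subseteq> verts G"
    and e: "e \<in> edges G" "v \<in> ends G e" "ends G e \<subseteq> insert v X"
  obtains R where "R \<subseteq> X" "card R = weight G B v e"
    "card {\<phi> \<in> PiE (insert v X) L. restrict \<phi> X \<in> partial_good G B L X \<and>
        restrict \<phi> (ends G e) \<in> B e} \<le> card (partial_good G B L (X - R))"
proof -
  obtain S where S: "S \<subseteq> ends G e - {v}" "determines S (B e)"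
    "card (ends G e - {v} - S) = weight G B v e"
    using weight_attained[OF inst e(1,2)] .
  define R where "R = ends G e - {v} - S"
  let ?D = "{\<phi> \<in> PiE (insert v X) L. restrict \<phi> X \<in> partial_good G B L X \<and>
        restrict \<phi> (ends G e) \<in> B e}"
  let ?r = "\<lambda>\<phi>. restrict \<phi> (X - R)"
  have "inj_on ?r ?D"
  proof (rule inj_onI)
    fix \<phi> \<psi> assume \<phi>: "\<phi> \<in> ?D" and \<psi>: "\<psi> \<in> ?D" and eq: "?r \<phi> = ?r \<psi>"
    have eqr: "\<phi> x = \<psi> x" if "x \<in> X - R" for x
      using fun_cong[OF eq, of x] that by simp
    \<comment> \<open>\<open>S\<close> avoids both \<open>v\<close> and \<open>R\<close>, so the
      agreement on \<open>X - R\<close> covers it.\<close>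
    have "x \<in> X - R \<and> x \<in> ends G e" if "x \<in> S" for x
      using that S(1) e(3) by (auto simp: R_def)
    then have "\<forall>x\<in>S. restrict \<phi> (ends G e) x = restrict \<psi> (ends G e) x"
      using eqr by simp
    then have "restrict \<phi> (ends G e) = restrict \<psi> (ends G e)"
      using S(2) \<phi> \<psi> unfolding determines_def by blast
    then have eqe: "\<phi> x = \<psi> x" if "x \<in> ends G e" for x
      using that by (metis restrict_apply')
    show "\<phi> = \<psi>"
    proof (rule PiE_ext)
      show "\<phi> \<in> PiE (insert v X) L" "\<psi> \<in> PiE (insert v X) L" using \<phi> \<psi> by auto
      \<comment> \<open>A vertex outside \<open>e\<close> is neither \<open>v\<close> nor in
        \<open>R\<close>, hence lies in \<open>X - R\<close>.\<close>
      show "\<phi> x = \<psi> x" if "x \<in> insert v X" for x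
        using that eqr eqe e(2) by (cases "x \<in> ends G e") (auto simp: R_def)
    qed
  qed
  moreover have "?r ` ?D \<subseteq> partial_good G B L (X - R)"
  proof (rule image_subsetI)
    fix \<phi> assume "\<phi> \<in> ?D"
    then have "restrict \<phi> X \<in> partial_good G B L X" by simp
    then have "restrict (restrict \<phi> X) (X - R) \<in> partial_good G B L (X - R)"
      by (rule partial_good_restrict) auto
    moreover have "restrict (restrict \<phi> X) (X - R) = ?r \<phi>"
      by (simp add: inf.absorb2)
    ultimately show "?r \<phi> \<in> partial_good G B L (X - R)" by simp
  qed
  ultimately have "card ?D \<le> card (partial_good G B L (X - R))"
    using X finite_good[of "X - R"] by (intro card_inj_on_le) auto
  moreover have "R \<subseteq> X" using e(3) by (auto simp: R_def)
  ultimately show thesis using that S(3) by (simp add: R_def)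
qed

text \<open>Edges through \<open>v\<close> are ignored here: an extension is a free choice from
  \<open>L v\<close> together with its restriction to \<open>X\<close>. This is the main term from
  which failures are subtracted.\<close>

lemma card_extensions:
  assumes "v \<in> verts G" "v \<notin> X"
  shows "card {\<phi> \<in> PiE (insert v X) L. restrict \<phi> X \<in> partial_good G B L X} =
    c * card (partial_good G B L X)"
proof -
  let ?E = "{\<phi> \<in> PiE (insert v X) L. restrict \<phi> X \<in> partial_good G B L X}"
  have "bij_betw (\<lambda>(a, \<psi>). \<psi>(v := a)) (L v \<times> partial_good G B L X) ?E"
  proof (rule bij_betw_byWitness[where f' = "\<lambda>\<phi>. (\<phi> v, restrict \<phi> X)"])
    have ext: "restrict (\<psi>(v := a)) X = \<psi>" if "\<psi> \<in> partial_good G B L X" for \<psi> a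
      using that assms(2) by (auto simp: partial_good_def PiE_iff extensional_def restrict_def fun_eq_iff)
    show "\<forall>p\<in>L v \<times> partial_good G B L X.
        (\<lambda>\<phi>. (\<phi> v, restrict \<phi> X)) ((\<lambda>(a, \<psi>). \<psi>(v := a)) p) = p"
      using ext by auto
    show "\<forall>\<phi>\<in>?E. (\<lambda>(a, \<psi>). \<psi>(v := a)) (\<phi> v, restrict \<phi> X) = \<phi>"
      by (auto simp: PiE_iff extensional_def fun_eq_iff)
    show "(\<lambda>(a, \<psi>). \<psi>(v := a)) ` (L v \<times> partial_good G B L X) \<subseteq> ?E"
    proof clarify
      fix a \<psi> assume a: "a \<in> L v" and \<psi>: "\<psi> \<in> partial_good G B L X"
      then have "\<psi>(v := a) \<in> PiE (insert v X) L"
        by (intro PiE_fun_upd) (auto simp: partial_good_def)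
      then show "\<psi>(v := a) \<in> PiE (insert v X) L \<and> restrict (\<psi>(v := a)) X \<in> partial_good G B L X"
        using \<psi> ext[OF \<psi>] by simp
    qed
    show "(\<lambda>\<phi>. (\<phi> v, restrict \<phi> X)) ` ?E \<subseteq> L v \<times> partial_good G B L X" by auto
  qed
  then have "card ?E = card (L v \<times> partial_good G B L X)" by (simp add: bij_betw_same_card)
  then show ?thesis using lists assms(1) by (simp add: card_cartesian_product list_assignment_def)
qed

text \<open>A union bound over the edges through \<open>v\<close>. The assumption \<open>IH\<close>
  allows any \<open>R\<close>, since the set removed for an edge is as large as the weight.\<close>

lemma card_partial_good_insert:
  fixes \<beta> :: real
  assumes \<beta>: "\<beta> \<ge> 1" and X: "insert v X \<subseteq> verts G" "v \<notin> X"
    and bound: "real c \<ge> \<beta> + (\<Sum>k. \<beta> powi (- int k) * real (E_count G B k v))"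
    and IH: "\<And>R. R \<subseteq> X \<Longrightarrow>
      \<beta> ^ card R * real (card (partial_good G B L (X - R))) \<le> real (card (partial_good G B L X))"
  shows "\<beta> * real (card (partial_good G B L X)) \<le> real (card (partial_good G B L (insert v X)))"
proof -
  let ?P = "\<lambda>X. real (card (partial_good G B L X))"
  let ?E = "{\<phi> \<in> PiE (insert v X) L. restrict \<phi> X \<in> partial_good G B L X}"
  let ?A = "{e \<in> edges G. v \<in> ends G e \<and> ends G e \<subseteq> insert v X}"
  let ?A' = "{e \<in> edges G. v \<in> ends G e}"
  let ?D = "\<lambda>e. {\<phi> \<in> PiE (insert v X) L. restrict \<phi> X \<in> partial_good G B L X \<and>
        restrict \<phi> (ends G e) \<in> B e}"
  let ?w = "\<lambda>e. \<beta> powi (- int (weight G B v e))"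
  have finE: "finite (edges G)" using inst by (simp add: is_instance_def is_hypergraph_def)
  have "finite (PiE (insert v X) L)"
    using X inst lists
    by (intro finite_PiE)
       (auto simp: is_instance_def is_hypergraph_def list_assignment_def intro: finite_subset)
  then have finD: "finite (?D e)" for e by simp
  \<comment> \<open>An edge on which an extension fails must contain \<open>v\<close>; otherwise it
    would lie in \<open>X\<close> and already spoil the restriction to \<open>X\<close>.\<close>
  have cover: "?E \<subseteq> partial_good G B L (insert v X) \<union> (\<Union>e\<in>?A. ?D e)"
  proof
    fix \<phi> assume \<phi>: "\<phi> \<in> ?E"
    show "\<phi> \<in> partial_good G B L (insert v X) \<union> (\<Union>e\<in>?A. ?D e)"
    proof (cases "\<phi> \<in> partial_good G B L (insert v X)")
      case False
      then obtain e where e: "e \<in> edges G" "ends G e \<subseteq> insert v X" "restrict \<phi> (ends G e) \<in> B e"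
        using \<phi> by (auto simp: partial_good_def)
      have "v \<in> ends G e"
      proof (rule ccontr)
        assume "v \<notin> ends G e"
        then have "ends G e \<subseteq> X" using e(2) by auto
        then show False using \<phi> e by (auto simp: partial_good_def inf.absorb2)
      qed
      then show ?thesis using e \<phi> by blast
    qed simp
  qed
  have "real c * ?P X = real (card ?E)"
    using card_extensions[of v X] X by simp
  also have "\<dots> \<le> real (card (partial_good G B L (insert v X) \<union> (\<Union>e\<in>?A. ?D e)))"
    using cover finE finD finite_good[OF X(1)] by (intro of_nat_mono card_mono) auto
  also have "\<dots> \<le> real (card (partial_good G B L (insert v X)) + card (\<Union>e\<in>?A. ?D e))"
    by (intro of_nat_mono card_Un_le)
  also have "\<dots> \<le> real (card (partial_good G B L (insert v X)) + (\<Sum>e\<in>?A. card (?D e)))"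
    using finE by (intro of_nat_mono add_left_mono card_UN_le) auto
  also have "\<dots> = ?P (insert v X) + (\<Sum>e\<in>?A. real (card (?D e)))" by simp
  also have "(\<Sum>e\<in>?A. real (card (?D e))) \<le> (\<Sum>e\<in>?A. ?w e * ?P X)"
  proof (rule sum_mono)
    fix e assume "e \<in> ?A"
    then obtain R where R: "R \<subseteq> X" "card R = weight G B v e"
      "card (?D e) \<le> card (partial_good G B L (X - R))"
      using card_bad_extensions[OF X(1), of e] by blast
    have "real (card (?D e)) \<le> ?P (X - R)" using R(3) by simp
    \<comment> \<open>\<open>IH\<close> for \<open>R\<close>, divided by \<beta> to the power
      \<open>card R\<close>.\<close>
    also have "\<dots> \<le> ?w e * ?P X"
      using IH[OF R(1)] R(2) \<beta> by (simp add: power_int_minus field_simps)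
    finally show "real (card (?D e)) \<le> ?w e * ?P X" .
  qed
  \<comment> \<open>\<open>E_count\<close> also counts edges through \<open>v\<close> that leave
    \<open>insert v X\<close>; adding their nonnegative terms only enlarges the sum.\<close>
  also have "\<dots> \<le> (\<Sum>e\<in>?A'. ?w e * ?P X)"
    using finE \<beta> by (intro sum_mono2) auto
  also have "\<dots> = (\<Sum>e\<in>?A'. ?w e) * ?P X" by (rule sum_distrib_right[symmetric])
  also have "\<dots> \<le> (real c - \<beta>) * ?P X"
    using bound unfolding suminf_E_count[OF finE] by (intro mult_right_mono) auto
  finally show ?thesis by (simp add: algebra_simps)
qed

text \<open>Deleting the vertices of \<open>X - Y\<close> one at a time costs a factor \<beta> each.
  Arbitrary \<open>Y\<close> is what the induction needs, because the one-vertex step removes whole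
  sets \<open>R\<close>.\<close>

lemma card_partial_good_mono:
  fixes \<beta> :: real
  assumes \<beta>: "\<beta> \<ge> 1"
    and bound: "\<And>v. v \<in> verts G \<Longrightarrow>
      real c \<ge> \<beta> + (\<Sum>k. \<beta> powi (- int k) * real (E_count G B k v))"
    and X: "X \<subseteq> verts G" "Y \<subseteq> X"
  shows "\<beta> ^ card (X - Y) * real (card (partial_good G B L Y)) \<le> real (card (partial_good G B L X))"
proof -
  have "finite X"
    using X inst by (auto simp: is_instance_def is_hypergraph_def intro: finite_subset)
  then show ?thesis using X
  proof (induction X arbitrary: Y rule: finite_psubset_induct)
    case (psubset X)
    show ?case
    proof (cases "Y = X")
      case False
      then obtain v where v: "v \<in> X" "v \<notin> Y" using psubset.prems by auto
      let ?X = "X - {v}"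
      have sub: "?X \<subset> X" using v by auto
      \<comment> \<open>Used twice: with \<open>Z = Y\<close> to reach \<open>?X\<close>, and with
        \<open>Z = ?X - R\<close> to supply the assumption of the one-vertex step.\<close>
      have IH: "\<beta> ^ card (?X - Z) * real (card (partial_good G B L Z))
          \<le> real (card (partial_good G B L ?X))" if "Z \<subseteq> ?X" for Z
        using psubset.IH[OF sub _ that] psubset.prems by auto
      have "X - Y = insert v (?X - Y)" using v by auto
      then have "card (X - Y) = Suc (card (?X - Y))" using psubset.hyps by simp
      then have "\<beta> ^ card (X - Y) * real (card (partial_good G B L Y)) =
          \<beta> * (\<beta> ^ card (?X - Y) * real (card (partial_good G B L Y)))"
        by simp
      also have "\<dots> \<le> \<beta> * real (card (partial_good G B L ?X))"
        using IH[of Y] v psubset.prems \<beta> by (intro mult_left_mono) auto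
      also have "\<dots> \<le> real (card (partial_good G B L (insert v ?X)))"
      proof (rule card_partial_good_insert[OF \<beta>])
        show "insert v ?X \<subseteq> verts G" "v \<notin> ?X" using v psubset.prems by auto
        then show "real c \<ge> \<beta> + (\<Sum>k. \<beta> powi (- int k) * real (E_count G B k v))"
          using bound by simp
        show "\<beta> ^ card R * real (card (partial_good G B L (?X - R)))
            \<le> real (card (partial_good G B L ?X))" if "R \<subseteq> ?X" for R
          using IH[of "?X - R"] that by (simp add: double_diff)
      qed
      also have "insert v ?X = X" using v by auto
      finally show ?thesis .
    qed simp
  qed
qed

end

theorem theorem3:
  fixes G :: "('v, 'e) hypergraph"
    and B :: "'e \<Rightarrow> ('v \<Rightarrow> int) set"
    and \<beta> :: real
    and c :: nat
  assumes "is_instance G B"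
    and empty_edge: "\<And>e. e \<in> edges G \<Longrightarrow> ends G e = {} \<Longrightarrow> B e = {}"
    and "\<beta> \<ge> 1"
    and "c \<ge> 1"
    and "\<And>v. v \<in> verts G \<Longrightarrow>
           real c \<ge> \<beta> + (\<Sum>k. \<beta> powi (- int k) * real (E_count G B k v))"
  shows "choosable G B c \<and>
         (\<forall>L. list_assignment G c L \<longrightarrow> real (num_good G B L) \<ge> \<beta> ^ card (verts G))"
proof -
  have count: "\<beta> ^ card (verts G) \<le> real (num_good G B L)" if "list_assignment G c L" for L
  proof -
    \<comment> \<open>Only empty edges fit inside the empty set. The instance condition, which
      ranges over the vertices of an edge, does not constrain them, so \<open>empty_edge\<close> is
      what keeps the empty colouring good.\<close>
    have "partial_good G B L {} = {\<lambda>_. undefined}"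
      using empty_edge by (auto simp: partial_good_def)
    moreover have "\<beta> ^ card (verts G - {}) * real (card (partial_good G B L {}))
        \<le> real (card (partial_good G B L (verts G)))"
      by (rule card_partial_good_mono[OF assms(1) that assms(3,5)]) auto
    ultimately show ?thesis
      using assms(1) by (simp add: num_good_def partial_good_verts is_instance_def)
  qed
  have "\<exists>\<phi>\<in>list_colourings G L. good G B \<phi>" if "list_assignment G c L" for L
  proof -
    have "0 < \<beta> ^ card (verts G)" using assms(3) by simp
    with count[OF that] have "num_good G B L \<noteq> 0" by auto
    then have "{\<phi> \<in> list_colourings G L. good G B \<phi>} \<noteq> {}"
      unfolding num_good_def by (metis card.empty)
    then show ?thesis by blast
  qed
  with count show ?thesis by (simp add: choosable_def)
qed

end
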